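(* Consider a statistical family consisting of an observation $y\in\mathcal{Y}$, a latent variable $w\in\mathcal{W}$ and an unknown parameter $\theta$ in a parameter space $\Theta$ (on which no assumptions are made). Assume that the joint variable $(y,w)$ is dominated, that is, $P_\theta((y,w)\in A)=\int_A p_\theta(y,w)\,d(\lambda\otimes\mu)(y,w)$ for a measure $\lambda$ on $\mathcal{Y}$ and a measure $\mu$ on $\mathcal{W}$, and assume that for every $\theta\in\Theta$, $p_\theta(y,w)$ is non-zero for almost all $w,y$. For the observation $y$, let $L(\theta):=p_\theta(y)$ and $L(\theta,w):=p_\theta(y,w)$. Let $\theta_1,\theta_2\in\Theta$. Then $L(\theta_1)<L(\theta_2)$ if and only if the following inequality is true: $$\int \min\left(1,\frac{L(\theta_2,w)}{L(\theta_1,w)}\right)\,dP_{\theta_1}(w\mid y)\;>\;\int \min\left(1,\frac{L(\theta_1,w)}{L(\theta_2,w)}\right)\,dP_{\theta_2}(w\mid y),$$ where $P_\theta(w\mid y)$ is the posterior distribution of $w$ under $\theta$ given $y$.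
   Context: $P_\theta$ denotes the joint distribution of $(y,w)$ under the parameter $\theta$, and $p_\theta(y,w)$ its density with respect to $\lambda\otimes\mu$. $p_\theta(y)=\int_{\mathcal{W}}p_\theta(y,w)\,d\mu(w)$ is the marginal density for $y$ under $\theta$. The posterior distribution $P_\theta(w\mid y)$ of $w$ under $\theta$ given $y$ is the distribution on $\mathcal{W}$ with density $w\mapsto L(\theta,w)/L(\theta)=p_\theta(y,w)/p_\theta(y)$ with respect to $\mu$. $L(\theta)$ is the marginal likelihood of the observation $y$.
   Formalization: The equivalence is stated for λ-almost every observation y, for fixed θ1, θ2 (it can fail on a λ-null set of y, where the densities may vanish), and μ is assumed σ-finite so that the product measure and marginal densities make sense. *)

theory Defs
  imports "HOL-Probability.Probability"
begin

text \<open>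
  A joint density is given as \<open>p \<theta> (y, w)\<close>, with \<open>y\<close> the observation and \<open>w\<close> the latent
  variable; \<open>mu\<close> is the reference measure on the space of \<open>w\<close>.

  The Bochner integral below is \<open>0\<close> if \<open>w \<mapsto> p \<theta> (y, w)\<close> is not integrable. For the density of
  a probability distribution that happens only on a null set of observations \<open>y\<close>.
\<close>

definition marginal_density ::
  "'w measure \<Rightarrow> ('t \<Rightarrow> 'y \<times> 'w \<Rightarrow> real) \<Rightarrow> 't \<Rightarrow> 'y \<Rightarrow> real"
  where "marginal_density mu p \<theta> y = (LINT w|mu. p \<theta> (y, w))"

definition posterior ::
  "'w measure \<Rightarrow> ('t \<Rightarrow> 'y \<times> 'w \<Rightarrow> real) \<Rightarrow> 't \<Rightarrow> 'y \<Rightarrow> 'w measure"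
  where "posterior mu p \<theta> y =
    density mu (\<lambda>w. ennreal (p \<theta> (y, w) / marginal_density mu p \<theta> y))"

end

theory Submission
  imports Defs
begin

text \<open>
  For one observation \<open>y\<close>, write \<open>f\<close> and \<open>g\<close> for the two likelihoods as functions of the latent
  variable. The weight \<open>min 1 (g / f)\<close> cancels against the posterior density \<open>f / \<integral>f\<close> and leaves
  \<open>min f g / \<integral>f\<close>, whose numerator is symmetric in \<open>f\<close> and \<open>g\<close>. The two averages compared in the
  theorem are thus the same number \<open>\<integral>min f g\<close> divided by \<open>\<integral>f\<close> and by \<open>\<integral>g\<close>, and this number is
  positive because both likelihoods are positive almost everywhere and the reference measure of a
  probability density is not null. So the average with the smaller marginal likelihood is the
  larger one.

  Almost every observation satisfies the conditions of this argument: Tonelli's theorem for the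
  joint density makes its sections integrable, and a property that holds almost everywhere on
  the product holds almost everywhere on almost every section.
\<close>

text \<open>
  The cancellation \<open>f * min 1 (g / f) = min f g\<close> holds where \<open>f\<close> does not vanish.
\<close>

lemma integral_density_min_ratio:
  fixes f g :: "'w \<Rightarrow> real" and c :: real
  assumes [measurable]: "f \<in> borel_measurable M" "g \<in> borel_measurable M"
    and pos: "AE w in M. 0 < f w" and c: "0 \<le> c"
  shows "(LINT w|density M (\<lambda>w. ennreal (f w / c)). min 1 (g w / f w)) =
    (LINT w|M. min (f w) (g w)) / c"
proof -
  have "(LINT w|density M (\<lambda>w. ennreal (f w / c)). min 1 (g w / f w)) =
      (LINT w|M. (f w / c) *\<^sub>R min 1 (g w / f w))"
    using pos c by (intro integral_density) auto
  also have "\<dots> = (LINT w|M. min (f w) (g w) / c)"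
    using pos by (intro integral_cong_AE) (auto simp: min_def field_simps)
  finally show ?thesis by simp
qed

text \<open>
  Both averages have the numerator \<open>\<integral>min f g\<close>, so the reciprocals of the marginals decide. On a
  null measure all the integrals are \<open>0\<close> and neither inequality holds; in all other cases this
  numerator and both marginals are positive.
\<close>

lemma marginal_less_iff_min_ratio_greater:
  fixes f g :: "'w \<Rightarrow> real"
  assumes f: "integrable M f" and g: "integrable M g"
    and f_pos: "AE w in M. 0 < f w" and g_pos: "AE w in M. 0 < g w"
  defines "F \<equiv> LINT w|M. f w" and "G \<equiv> LINT w|M. g w"
  shows "F < G \<longleftrightarrow>
    (LINT w|density M (\<lambda>w. ennreal (f w / F)). min 1 (g w / f w)) >
    (LINT w|density M (\<lambda>w. ennreal (g w / G)). min 1 (f w / g w))"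
proof -
  define m where "m = (LINT w|M. min (f w) (g w))"
  have int_pos: "0 < (LINT w|M. h w)"
    if "emeasure M (space M) \<noteq> 0" "integrable M h" "AE w in M. 0 < h w" for h :: "'w \<Rightarrow> real"
  proof -
    have ae: "AE w in M. 0 \<le> h w"
      using that(3) by eventually_elim simp
    have "(LINT w|M. h w) \<noteq> 0"
    proof
      assume "(LINT w|M. h w) = 0"
      then have "AE w in M. h w = 0"
        using integral_nonneg_eq_0_iff_AE[OF that(2) ae] by simp
      with that(3) have "AE w in M. False"
        by eventually_elim simp
      then show False
        using that(1) by (simp add: AE_iff_null null_sets_def)
    qed
    then show ?thesis
      using integral_nonneg_AE[OF ae] by simp
  qed
  have nonneg: "0 \<le> F" "0 \<le> G"
    unfolding F_def G_def using f_pos g_pos by (auto intro!: integral_nonneg_AE)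
  have min_pos: "AE w in M. 0 < min (f w) (g w)"
    using f_pos g_pos by eventually_elim simp
  have averages:
    "(LINT w|density M (\<lambda>w. ennreal (f w / F)). min 1 (g w / f w)) = m / F"
    "(LINT w|density M (\<lambda>w. ennreal (g w / G)). min 1 (f w / g w)) = m / G"
    using integral_density_min_ratio[of f M g F] integral_density_min_ratio[of g M f G]
      f g f_pos g_pos nonneg by (auto simp: m_def min.commute)
  have "F < G \<longleftrightarrow> m / F > m / G"
  proof (cases "emeasure M (space M) = 0")
    case True
    then have "F = 0" "G = 0"
      unfolding F_def G_def by (auto intro!: integral_eq_zero_AE emeasure_0_AE)
    then show ?thesis by simp
  next
    case False
    then have "0 < F" "0 < G" "0 < m"
      unfolding F_def G_def m_def using f g f_pos g_pos min_pos by (auto intro!: int_pos)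
    then show ?thesis by (simp add: divide_less_cancel field_simps)
  qed
  then show ?thesis by (simp add: averages)
qed

text \<open>
  Almost all sections of a null set of the product are null: by Tonelli's theorem the integral
  of the measures of the sections is the measure of the set.
\<close>

lemma AE_section:
  assumes "sigma_finite_measure M" and "AE z in N \<Otimes>\<^sub>M M. Q z"
  shows "AE y in N. AE w in M. Q (y, w)"
proof -
  interpret sigma_finite_measure M by fact
  obtain Z where [measurable]: "Z \<in> sets (N \<Otimes>\<^sub>M M)" and null: "emeasure (N \<Otimes>\<^sub>M M) Z = 0"
    and Z: "{z \<in> space (N \<Otimes>\<^sub>M M). \<not> Q z} \<subseteq> Z"
    using assms(2) by (auto elim!: AE_E)
  have "(\<integral>\<^sup>+y. emeasure M (Pair y -` Z) \<partial>N) = 0"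
    using null by (simp add: emeasure_pair_measure_alt)
  then have "AE y in N. emeasure M (Pair y -` Z) = 0"
    by (subst (asm) nn_integral_0_iff_AE) (auto intro: measurable_emeasure_Pair)
  with AE_space show ?thesis
  proof eventually_elim
    case (elim y)
    then show ?case
      using Z by (intro AE_I[of _ _ "Pair y -` Z"]) (auto simp: space_pair_measure sets_Pair1)
  qed
qed

lemma AE_integrable_section:
  fixes q :: "'y \<times> 'w \<Rightarrow> real"
  assumes "sigma_finite_measure M"
    and [measurable]: "q \<in> borel_measurable (N \<Otimes>\<^sub>M M)"
    and nonneg: "\<And>z. z \<in> space (N \<Otimes>\<^sub>M M) \<Longrightarrow> 0 \<le> q z"
    and finite: "(\<integral>\<^sup>+z. ennreal (q z) \<partial>(N \<Otimes>\<^sub>M M)) \<noteq> \<infinity>"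
  shows "AE y in N. integrable M (\<lambda>w. q (y, w))"
proof -
  interpret sigma_finite_measure M by fact
  have "(\<integral>\<^sup>+y. (\<integral>\<^sup>+w. ennreal (q (y, w)) \<partial>M) \<partial>N) \<noteq> \<infinity>"
    using finite nn_integral_fst[of "\<lambda>z. ennreal (q z)" N] by simp
  then have "AE y in N. (\<integral>\<^sup>+w. ennreal (q (y, w)) \<partial>M) \<noteq> \<infinity>"
    by (intro nn_integral_PInf_AE) measurable
  with AE_space show ?thesis
  proof eventually_elim
    case (elim y)
    then show ?case
      by (intro integrableI_nonneg) (auto simp: less_top nonneg space_pair_measure)
  qed
qed

lemma AE_positive_section:
  fixes q :: "'y \<times> 'w \<Rightarrow> real"
  assumes "sigma_finite_measure M"
    and nonneg: "\<And>z. z \<in> space (N \<Otimes>\<^sub>M M) \<Longrightarrow> 0 \<le> q z"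
    and nonzero: "AE z in N \<Otimes>\<^sub>M M. q z \<noteq> 0"
  shows "AE y in N. AE w in M. 0 < q (y, w)"
proof -
  have "AE z in N \<Otimes>\<^sub>M M. 0 < q z"
    using nonzero AE_space by eventually_elim (use nonneg in \<open>force simp: less_le\<close>)
  with assms(1) show ?thesis by (rule AE_section)
qed

theorem theorem1:
  fixes Theta :: "'t set"
    and lam :: "'y measure" and mu :: "'w measure"
    and P :: "'t \<Rightarrow> ('y \<times> 'w) measure"
    and p :: "'t \<Rightarrow> 'y \<times> 'w \<Rightarrow> real"
    and \<theta>1 \<theta>2 :: 't
  assumes sigma_finite: "sigma_finite_measure mu"
    and prob: "\<And>\<theta>. \<theta> \<in> Theta \<Longrightarrow> prob_space (P \<theta>)"
    and measurable: "\<And>\<theta>. \<theta> \<in> Theta \<Longrightarrow> p \<theta> \<in> borel_measurable (lam \<Otimes>\<^sub>M mu)"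
    and nonneg: "\<And>\<theta> z. \<theta> \<in> Theta \<Longrightarrow> z \<in> space (lam \<Otimes>\<^sub>M mu) \<Longrightarrow> 0 \<le> p \<theta> z"
    and dominated: "\<And>\<theta>. \<theta> \<in> Theta \<Longrightarrow> P \<theta> = density (lam \<Otimes>\<^sub>M mu) (\<lambda>z. ennreal (p \<theta> z))"
    and nonzero: "\<And>\<theta>. \<theta> \<in> Theta \<Longrightarrow> AE z in lam \<Otimes>\<^sub>M mu. p \<theta> z \<noteq> 0"
    and "\<theta>1 \<in> Theta" and "\<theta>2 \<in> Theta"
  shows "AE y in lam.
    marginal_density mu p \<theta>1 y < marginal_density mu p \<theta>2 y \<longleftrightarrow>
      (LINT w|posterior mu p \<theta>1 y. min 1 (p \<theta>2 (y, w) / p \<theta>1 (y, w))) >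
      (LINT w|posterior mu p \<theta>2 y. min 1 (p \<theta>1 (y, w) / p \<theta>2 (y, w)))"
proof -
  have section_integrable: "AE y in lam. integrable mu (\<lambda>w. p \<theta> (y, w))" if "\<theta> \<in> Theta" for \<theta>
  proof (rule AE_integrable_section[OF sigma_finite])
    note [measurable] = measurable[OF that]
    have "(\<integral>\<^sup>+z. ennreal (p \<theta> z) \<partial>(lam \<Otimes>\<^sub>M mu)) = emeasure (P \<theta>) (space (P \<theta>))"
      unfolding dominated[OF that] by (simp add: emeasure_density cong: nn_integral_cong)
    also have "\<dots> = 1"
      using prob[OF that] by (rule prob_space.emeasure_space_1)
    finally show "(\<integral>\<^sup>+z. ennreal (p \<theta> z) \<partial>(lam \<Otimes>\<^sub>M mu)) \<noteq> \<infinity>"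
      by simp
  qed (use that measurable nonneg in auto)
  have section_positive: "AE y in lam. AE w in mu. 0 < p \<theta> (y, w)" if "\<theta> \<in> Theta" for \<theta>
    using AE_positive_section[OF sigma_finite] nonneg[OF that] nonzero[OF that] by blast
  note ae = section_integrable[OF \<open>\<theta>1 \<in> Theta\<close>] section_integrable[OF \<open>\<theta>2 \<in> Theta\<close>]
    section_positive[OF \<open>\<theta>1 \<in> Theta\<close>] section_positive[OF \<open>\<theta>2 \<in> Theta\<close>]
  show ?thesis
    using ae
  proof eventually_elim
    case (elim y)
    then show ?case
      unfolding posterior_def marginal_density_def
      by (rule marginal_less_iff_min_ratio_greater)
  qed
qed

end
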